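(* Let $r\ge 1$ and let $n_1,\ldots,n_r$ be positive integers, exactly $s$ of which are odd. Let $a\ge 0$ be an integer with $(2a)^2\le s<(2a+2)^2$. Let $K_{n_1,\ldots,n_r}$ be the complete $r$-partite graph with parts of sizes $n_1,\ldots,n_r$. Then: (i) - $\mathscr{D}_1(K_{n_1,\ldots,n_r})=\sqrt{s}$ if $s$ is a perfect square; - $\mathscr{D}_1(K_{n_1,\ldots,n_r})\le \frac{1}{2}\big(s+1-(2a-1)^2\big)$ if $(2a)^2<s<(2a+1)^2$ and $s$ is even; - $\mathscr{D}_1(K_{n_1,\ldots,n_r})\le \frac{1}{2}\big(s+1-(2a-2)^2\big)$ if $(2a)^2<s<(2a+1)^2$ and $s$ is odd; - $\mathscr{D}_1(K_{n_1,\ldots,n_r})\le \frac{1}{2}\big(s+1-(2a-1)^2\big)$ if $(2a+1)^2<s<(2a+2)^2$ and $s$ is even; - $\mathscr{D}_1(K_{n_1,\ldots,n_r})\le \frac{1}{2}\big(s+1-(2a)^2\big)$ if $(2a+1)^2<s<(2a+2)^2$ and $s$ is odd. Moreover, in all cases, $$\lfloor\sqrt{s}\rfloor\le \mathscr{D}_1(K_{n_1,\ldots,n_r})\le 3\lfloor\sqrt{s}\rfloor .$$ (ii) $$\mathscr{D}_2(K_{n_1,\ldots,n_r})=\left\lfloor\tfrac{s}{2}\right\rfloor .$$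
   Context: All graphs are finite and simple. For a graph $G$ and a labelling $f: V(G)\to\{0,1\}$, the induced edge labelling is $\overline{f}(xy)=|f(x)-f(y)|$ for $xy\in E(G)$. For $i\in\{0,1\}$, $v_i(f)$ is the number of vertices with label $i$ and $e_i(f)$ is the number of edges with induced label $i$. Put $\Delta_v(f)=|v_0(f)-v_1(f)|$ and $\Delta_e(f)=|e_0(f)-e_1(f)|$. Define $$\mathscr{D}_1(G)=\min_{f}\{\Delta_v(f)+\Delta_e(f)\},\qquad \mathscr{D}_2(G)=\min_{f:\,\Delta_v(f)\le 1}\{\Delta_e(f)\},$$ where the first minimum is over all labellings $f:V(G)\to\{0,1\}$ and the second is over those with $\Delta_v(f)\le 1$. The complete $r$-partite graph $K_{n_1,\ldots,n_r}$ has vertex set partitioned into sets $X_1,\ldots,X_r$ with $|X_i|=n_i$, two vertices being adjacent if and only if they lie in different sets $X_i$. *)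

theory Defs
  imports Complex_Main "HOL-Library.FuncSet" "HOL-Library.Disjoint_Sets"
begin

record 'a graph =
  verts :: "'a set"
  edges :: "'a set set"

definition simple_graph :: "'a graph \<Rightarrow> bool" where
  "simple_graph G \<longleftrightarrow> finite (verts G) \<and> (\<forall>e \<in> edges G. e \<subseteq> verts G \<and> card e = 2)"

(* Labels are integers, so that subtraction in the induced label is not truncated.
   Labellings are extensional (undefined outside the vertex set), so that each map from
   the vertex set to {0, 1} is represented exactly once. *)
definition labellings :: "'a graph \<Rightarrow> ('a \<Rightarrow> int) set" where
  "labellings G = verts G \<rightarrow>\<^sub>E {0, 1}"

definition induced_label :: "('a \<Rightarrow> int) \<Rightarrow> 'a set \<Rightarrow> int" where
  "induced_label f e = (THE l. \<exists>x y. e = {x, y} \<and> l = \<bar>f x - f y\<bar>)"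

lemma induced_label_doubleton [simp]: "induced_label f {x, y} = \<bar>f x - f y\<bar>"
  unfolding induced_label_def
  by (rule the_equality) (auto simp: doubleton_eq_iff)

definition v_count :: "'a graph \<Rightarrow> int \<Rightarrow> ('a \<Rightarrow> int) \<Rightarrow> nat" where
  "v_count G i f = card {x \<in> verts G. f x = i}"

definition e_count :: "'a graph \<Rightarrow> int \<Rightarrow> ('a \<Rightarrow> int) \<Rightarrow> nat" where
  "e_count G i f = card {e \<in> edges G. induced_label f e = i}"

definition Delta_v :: "'a graph \<Rightarrow> ('a \<Rightarrow> int) \<Rightarrow> int" where
  "Delta_v G f = \<bar>int (v_count G 0 f) - int (v_count G 1 f)\<bar>"

definition Delta_e :: "'a graph \<Rightarrow> ('a \<Rightarrow> int) \<Rightarrow> int" where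
  "Delta_e G f = \<bar>int (e_count G 0 f) - int (e_count G 1 f)\<bar>"

definition D1 :: "'a graph \<Rightarrow> int" where
  "D1 G = Min ((\<lambda>f. Delta_v G f + Delta_e G f) ` labellings G)"

definition D2 :: "'a graph \<Rightarrow> int" where
  "D2 G = Min (Delta_e G ` {f \<in> labellings G. Delta_v G f \<le> 1})"

(* Min is unspecified on empty or infinite sets; the next three lemmas show that both
   minima above are taken over finite nonempty sets. *)
lemma finite_labellings: "simple_graph G \<Longrightarrow> finite (labellings G)"
  unfolding simple_graph_def labellings_def by (auto intro: finite_PiE)

lemma labellings_nonempty: "labellings G \<noteq> {}"
  unfolding labellings_def by (simp add: PiE_eq_empty_iff)

lemma balanced_labellings_nonempty:
  assumes "simple_graph G"
  shows "{f \<in> labellings G. Delta_v G f \<le> 1} \<noteq> {}"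
proof -
  have fin: "finite (verts G)" using assms by (simp add: simple_graph_def)
  obtain A where A: "A \<subseteq> verts G" "card A = card (verts G) div 2"
    by (meson div_le_dividend obtain_subset_with_card_n)
  define f where "f = (\<lambda>x. if x \<in> verts G then (if x \<in> A then 1 else 0) else undefined :: int)"
  have "f \<in> labellings G" by (auto simp: f_def labellings_def split: if_splits)
  moreover have "{x \<in> verts G. f x = 0} = verts G - A" "{x \<in> verts G. f x = 1} = A"
    using A by (auto simp: f_def split: if_splits)
  then have "v_count G 0 f = card (verts G) - card (verts G) div 2"
    "v_count G 1 f = card (verts G) div 2"
    using A fin by (auto simp: v_count_def card_Diff_subset finite_subset)
  then have "Delta_v G f \<le> 1" unfolding Delta_v_def by linarith
  ultimately show ?thesis by blast
qed

(* G is (a copy of) the complete r-partite graph with parts of sizes n 1, ..., n r. *)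
definition complete_multipartite :: "nat \<Rightarrow> (nat \<Rightarrow> nat) \<Rightarrow> 'a graph \<Rightarrow> bool" where
  "complete_multipartite r n G \<longleftrightarrow> simple_graph G \<and>
    (\<exists>X. verts G = (\<Union>i\<in>{1..r}. X i) \<and> disjoint_family_on X {1..r} \<and>
         (\<forall>i\<in>{1..r}. card (X i) = n i) \<and>
         (\<forall>i\<in>{1..r}. \<forall>j\<in>{1..r}. \<forall>x\<in>X i. \<forall>y\<in>X j. {x, y} \<in> edges G \<longleftrightarrow> i \<noteq> j))"

lemma complete_multipartite_exists:
  "\<exists>G :: (nat \<times> nat) graph. complete_multipartite r n G"
proof -
  define X where "X = (\<lambda>i. {i} \<times> {..<n i})"
  define V where "V = (\<Union>i\<in>{1..r}. X i)"
  define E where "E = {{x, y} | x y. x \<in> V \<and> y \<in> V \<and> fst x \<noteq> fst y}"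
  define G where "G = \<lparr>verts = V, edges = E\<rparr>"
  have "simple_graph G"
    unfolding simple_graph_def G_def E_def
    by (auto simp: V_def X_def card_2_iff)
  moreover have "disjoint_family_on X {1..r}" by (auto simp: disjoint_family_on_def X_def)
  moreover have "\<forall>i\<in>{1..r}. card (X i) = n i"
    by (simp add: X_def)
  moreover have "{x, y} \<in> E \<longleftrightarrow> i \<noteq> j"
    if "i \<in> {1..r}" "j \<in> {1..r}" "x \<in> X i" "y \<in> X j" for i j x y
  proof -
    have "x \<in> V" "y \<in> V" "fst x = i" "fst y = j" using that by (auto simp: V_def X_def)
    then show ?thesis unfolding E_def by (smt (verit) doubleton_eq_iff mem_Collect_eq)
  qed
  ultimately have "complete_multipartite r n G"
    unfolding complete_multipartite_def
    by (intro conjI exI[of _ X]) (simp_all add: G_def V_def)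
  then show ?thesis ..
qed

end

theory Submission
  imports Defs
begin

text \<open>
  Replace the labels \<open>0, 1\<close> by the signs \<open>+1, -1\<close>. A labelling then has on each part \<open>X\<^sub>i\<close> a signed
  sum \<open>d\<^sub>i\<close>, the induced label of an edge becomes the product of the signs of its ends, and with
  \<open>D = \<Sum>d\<^sub>i\<close> and \<open>Q = \<Sum>d\<^sub>i\<^sup>2\<close> one gets \<open>\<Delta>\<^sub>v = \<bar>D\<bar>\<close> and, since \<open>D\<^sup>2\<close> expands over all ordered pairs of
  vertices and \<open>Q\<close> over the pairs inside a part, \<open>2\<Delta>\<^sub>e = \<bar>D\<^sup>2 - Q\<bar>\<close> (\<open>Delta_v_eq\<close>, \<open>two_Delta_e\<close>).

  The number \<open>s\<close> of odd parts enters through parity: \<open>d\<^sub>i\<close> has the parity of \<open>n\<^sub>i\<close>, so \<open>Q \<ge> s\<close>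
  (\<open>odd_parts_le\<close>). Conversely, splitting every part as evenly as possible gives \<open>Q = s\<close>, and
  choosing on which side the surplus vertex of each odd part falls makes \<open>D\<close> equal to any \<open>d \<le> s\<close> of
  the parity of \<open>s\<close> (\<open>near_even_labelling\<close>).

  The rest is arithmetic. All upper bounds for \<open>\<D>\<^sub>1\<close> are the value \<open>d + (s - d\<^sup>2) / 2\<close> at the largest
  \<open>d \<le> \<surd>s\<close> of the parity of \<open>s\<close>. The lower bound \<open>k = \<lfloor>\<surd>s\<rfloor>\<close> is clear if \<open>\<bar>D\<bar> \<ge> k\<close>; otherwise the
  deficit \<open>k - \<bar>D\<bar>\<close> is made up by \<open>(Q - D\<^sup>2) / 2 \<ge> (k\<^sup>2 - D\<^sup>2) / 2\<close>, up to rounding to an integer. For \<open>\<D>\<^sub>2\<close>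
  the constraint \<open>D\<^sup>2 \<le> 1\<close> forces \<open>\<Delta>\<^sub>e \<ge> (s - 1) / 2\<close>, and the least \<open>d\<close> of the parity of \<open>s\<close>, which is
  \<open>0\<close> or \<open>1\<close>, attains the rounded bound.
\<close>

section \<open>Counting labels by signs\<close>

definition signed_sum :: "('a \<Rightarrow> int) \<Rightarrow> 'a set \<Rightarrow> int" where
  "signed_sum f S = (\<Sum>x\<in>S. 1 - 2 * f x)"

lemma card_diff_eq_signed_sum:
  assumes "finite S" "\<And>x. x \<in> S \<Longrightarrow> f x \<in> {0, 1}"
  shows "int (card {x \<in> S. f x = 0}) - int (card {x \<in> S. f x = 1}) = signed_sum f S"
proof -
  have "(\<Sum>x\<in>S. 1 - 2 * f x)
      = (\<Sum>x\<in>S. (if f x = 0 then 1 else 0) - (if f x = 1 then 1 else (0::int)))"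
    using assms(2) by (intro sum.cong) auto
  also have "\<dots> = int (card {x \<in> S. f x = 0}) - int (card {x \<in> S. f x = 1})"
    using assms(1) by (simp only: sum_subtractf flip: sum.inter_filter) simp
  finally show ?thesis by (simp add: signed_sum_def)
qed

lemma even_signed_sum_iff: "even (signed_sum f S) \<longleftrightarrow> even (card S)"
proof -
  have "signed_sum f S = int (card S) - 2 * sum f S"
    by (simp add: signed_sum_def sum_subtractf sum_distrib_left)
  then show ?thesis by simp
qed

text \<open>Every edge is an unordered pair, so it comes from exactly two ordered ones.\<close>

lemma double_sum_edges:
  fixes h :: "'a set \<Rightarrow> int"
  assumes "simple_graph G"
  shows "2 * (\<Sum>e\<in>edges G. h e)
    = (\<Sum>x\<in>verts G. \<Sum>y\<in>verts G. if {x, y} \<in> edges G then h {x, y} else 0)"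
proof -
  let ?V = "verts G" and ?E = "edges G"
  let ?A = "{p \<in> ?V \<times> ?V. {fst p, snd p} \<in> ?E}"
  have edge: "e \<subseteq> ?V" "card e = 2" if "e \<in> ?E" for e
    using assms that by (auto simp: simple_graph_def)
  have finV: "finite ?V" using assms by (simp add: simple_graph_def)
  have finE: "finite ?E"
    by (rule finite_subset[of _ "Pow ?V"]) (use finV edge in auto)
  have "(\<Sum>x\<in>?V. \<Sum>y\<in>?V. if {x, y} \<in> ?E then h {x, y} else 0)
      = (\<Sum>p\<in>?V \<times> ?V. if {fst p, snd p} \<in> ?E then h {fst p, snd p} else 0)"
    by (simp add: sum.cartesian_product case_prod_unfold)
  also have "\<dots> = (\<Sum>p\<in>?A. h {fst p, snd p})"
    using finV by (intro sum.inter_filter[symmetric]) simp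
  also have "\<dots> = (\<Sum>e\<in>?E. \<Sum>p\<in>{p \<in> ?A. {fst p, snd p} = e}. h {fst p, snd p})"
    using finV finE by (intro sum.group[symmetric]) auto
  also have "\<dots> = (\<Sum>e\<in>?E. 2 * h e)"
  proof (rule sum.cong)
    fix e assume e: "e \<in> ?E"
    obtain u v where uv: "e = {u, v}" "u \<noteq> v"
      using edge(2)[OF e] by (auto simp: card_2_iff)
    have "{p \<in> ?A. {fst p, snd p} = e} = {(u, v), (v, u)}"
      using uv e edge(1)[OF e] by (auto simp: doubleton_eq_iff insert_commute)
    then show "(\<Sum>p\<in>{p \<in> ?A. {fst p, snd p} = e}. h {fst p, snd p}) = 2 * h e"
      using uv by (simp add: insert_commute)
  qed simp
  finally show ?thesis by (simp add: sum_distrib_left)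
qed

text \<open>For labels in \<open>{0, 1}\<close> the sign of an edge is the product of the signs of its ends.\<close>

lemma e_count_diff:
  assumes simple: "simple_graph G" and f: "f \<in> labellings G"
  shows "2 * (int (e_count G 0 f) - int (e_count G 1 f))
    = (\<Sum>x\<in>verts G. \<Sum>y\<in>verts G.
        if {x, y} \<in> edges G then (1 - 2 * f x) * (1 - 2 * f y) else 0)"
proof -
  have f01: "f x \<in> {0, 1}" if "x \<in> verts G" for x
    using f that by (auto simp: labellings_def)
  have edge: "induced_label f e \<in> {0, 1}" if e: "e \<in> edges G" for e
  proof -
    have "card e = 2" "e \<subseteq> verts G" using simple e by (auto simp: simple_graph_def)
    then obtain u v where uv: "e = {u, v}" "u \<in> verts G" "v \<in> verts G"
      by (auto simp: card_2_iff)
    then show ?thesis using f01[of u] f01[of v] by auto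
  qed
  have finE: "finite (edges G)"
    by (rule finite_subset[of _ "Pow (verts G)"]) (use simple in \<open>auto simp: simple_graph_def\<close>)
  have "int (e_count G 0 f) - int (e_count G 1 f) = (\<Sum>e\<in>edges G. 1 - 2 * induced_label f e)"
    using card_diff_eq_signed_sum[OF finE edge] by (simp only: e_count_def signed_sum_def)
  then have "2 * (int (e_count G 0 f) - int (e_count G 1 f))
      = (\<Sum>x\<in>verts G. \<Sum>y\<in>verts G.
          if {x, y} \<in> edges G then 1 - 2 * \<bar>f x - f y\<bar> else 0)"
    by (simp only: double_sum_edges[OF simple] induced_label_doubleton)
  also have "\<dots> = (\<Sum>x\<in>verts G. \<Sum>y\<in>verts G.
      if {x, y} \<in> edges G then (1 - 2 * f x) * (1 - 2 * f y) else 0)"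
  proof (intro sum.cong refl if_cong)
    fix x y assume "x \<in> verts G" "y \<in> verts G"
    with f01[of x] f01[of y]
    show "1 - 2 * \<bar>f x - f y\<bar> = (1 - 2 * f x) * (1 - 2 * f y)" by auto
  qed
  finally show ?thesis .
qed

section \<open>Imbalances of a complete multipartite graph\<close>

locale multipartite =
  fixes G :: "'a graph" and I :: "'b set" and X :: "'b \<Rightarrow> 'a set"
  assumes simple: "simple_graph G"
    and finite_index: "finite I"
    and verts_eq: "verts G = (\<Union>i\<in>I. X i)"
    and disjoint: "disjoint_family_on X I"
    and adjacent_iff:
      "\<And>i j x y. \<lbrakk>i \<in> I; j \<in> I; x \<in> X i; y \<in> X j\<rbrakk> \<Longrightarrow> {x, y} \<in> edges G \<longleftrightarrow> i \<noteq> j"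
begin

lemma finite_verts: "finite (verts G)"
  using simple by (simp add: simple_graph_def)

lemma finite_part: "i \<in> I \<Longrightarrow> finite (X i)"
  by (rule finite_subset[OF _ finite_verts]) (auto simp: verts_eq)

lemma sum_verts: "sum h (verts G) = (\<Sum>i\<in>I. sum h (X i))"
  unfolding verts_eq
proof (rule sum.UNION_disjoint[OF finite_index])
  show "\<forall>i\<in>I. finite (X i)" using finite_part by blast
  show "\<forall>i\<in>I. \<forall>j\<in>I. i \<noteq> j \<longrightarrow> X i \<inter> X j = {}"
    using disjoint unfolding disjoint_family_on_def .
qed

definition odd_parts :: nat where
  "odd_parts = card {i \<in> I. odd (card (X i))}"

definition total_sum :: "('a \<Rightarrow> int) \<Rightarrow> int" where
  "total_sum f = (\<Sum>i\<in>I. signed_sum f (X i))"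

definition squares :: "('a \<Rightarrow> int) \<Rightarrow> int" where
  "squares f = (\<Sum>i\<in>I. (signed_sum f (X i))\<^sup>2)"

lemma Delta_v_eq:
  assumes "f \<in> labellings G"
  shows "Delta_v G f = \<bar>total_sum f\<bar>"
proof -
  have "int (v_count G 0 f) - int (v_count G 1 f) = signed_sum f (verts G)"
    unfolding v_count_def
    using assms finite_verts by (intro card_diff_eq_signed_sum) (auto simp: labellings_def)
  then show ?thesis
    by (simp add: Delta_v_def total_sum_def signed_sum_def sum_verts)
qed

text \<open>The ordered adjacent pairs are all ordered pairs without those inside a part.\<close>

lemma sum_adjacent_pairs:
  fixes g :: "'a \<Rightarrow> int"
  shows "(\<Sum>x\<in>verts G. \<Sum>y\<in>verts G. if {x, y} \<in> edges G then g x * g y else 0)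
    = (\<Sum>i\<in>I. sum g (X i))\<^sup>2 - (\<Sum>i\<in>I. (sum g (X i))\<^sup>2)"
proof -
  let ?d = "\<lambda>i. sum g (X i)"
  have row: "(\<Sum>y\<in>verts G. if {x, y} \<in> edges G then g x * g y else 0)
      = g x * (\<Sum>j\<in>I. ?d j) - g x * ?d i" if i: "i \<in> I" and x: "x \<in> X i" for i x
  proof -
    have "(\<Sum>y\<in>verts G. if {x, y} \<in> edges G then g x * g y else 0)
        = (\<Sum>j\<in>I. \<Sum>y\<in>X j. if i = j then 0 else g x * g y)"
      unfolding sum_verts
    proof (intro sum.cong refl)
      fix j y assume "j \<in> I" "y \<in> X j"
      from adjacent_iff[OF i this(1) x this(2)]
      show "(if {x, y} \<in> edges G then g x * g y else 0) = (if i = j then 0 else g x * g y)" by simp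
    qed
    also have "\<dots> = (\<Sum>j\<in>I. g x * ?d j - (if i = j then g x * ?d j else 0))"
      by (intro sum.cong refl) (simp add: sum_distrib_left)
    also have "\<dots> = g x * (\<Sum>j\<in>I. ?d j) - g x * ?d i"
      using finite_index i by (simp add: sum_subtractf sum_distrib_left)
    finally show ?thesis .
  qed
  have "(\<Sum>x\<in>verts G. \<Sum>y\<in>verts G. if {x, y} \<in> edges G then g x * g y else 0)
      = (\<Sum>i\<in>I. \<Sum>x\<in>X i. g x * (\<Sum>j\<in>I. ?d j) - g x * ?d i)"
    unfolding sum_verts[of "\<lambda>x. \<Sum>y\<in>verts G. if {x, y} \<in> edges G then g x * g y else 0"]
    by (rule sum.cong[OF refl], rule sum.cong[OF refl], rule row)
  also have "\<dots> = (\<Sum>i\<in>I. ?d i * (\<Sum>j\<in>I. ?d j) - ?d i * ?d i)"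
    by (simp only: sum_subtractf sum_distrib_right)
  also have "\<dots> = (\<Sum>i\<in>I. ?d i)\<^sup>2 - (\<Sum>i\<in>I. (?d i)\<^sup>2)"
    by (simp only: sum_subtractf sum_distrib_right power2_eq_square)
  finally show ?thesis .
qed

lemma two_Delta_e:
  assumes f: "f \<in> labellings G"
  shows "2 * Delta_e G f = \<bar>(total_sum f)\<^sup>2 - squares f\<bar>"
proof -
  let ?diff = "int (e_count G 0 f) - int (e_count G 1 f)"
  have "2 * ?diff = (total_sum f)\<^sup>2 - squares f"
    unfolding e_count_diff[OF simple f] sum_adjacent_pairs total_sum_def squares_def
    by (simp only: signed_sum_def)
  then show ?thesis unfolding Delta_e_def by (metis abs_mult abs_numeral)
qed

text \<open>An odd part has an odd signed sum, whose square is at least 1.\<close>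

lemma odd_parts_le: "int odd_parts \<le> squares f"
proof -
  have "int odd_parts = (\<Sum>i\<in>I. if odd (card (X i)) then 1 else 0)"
    using finite_index by (simp add: odd_parts_def flip: sum.inter_filter)
  also have "\<dots> \<le> squares f"
    unfolding squares_def
  proof (rule sum_mono)
    fix i assume "i \<in> I"
    have "1 \<le> (signed_sum f (X i))\<^sup>2" if "odd (card (X i))"
    proof -
      have "signed_sum f (X i) \<noteq> 0" using that even_signed_sum_iff[of f "X i"] by auto
      then show ?thesis using zero_less_power2[of "signed_sum f (X i)"] by linarith
    qed
    then show "(if odd (card (X i)) then 1 else 0) \<le> (signed_sum f (X i))\<^sup>2" by simp
  qed
  finally show ?thesis .
qed

text \<open>
  Splitting the part \<open>X i\<close> into halves, up to one surplus vertex if its size is odd, gives the signed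
  sum \<open>0\<close> or \<open>\<plusminus>1\<close>. If the surplus is labelled \<open>0\<close> in \<open>p\<close> of the \<open>s\<close> odd parts, the total is \<open>2p - s\<close>.
\<close>

lemma near_even_labelling:
  assumes d: "d \<le> odd_parts" "even (odd_parts + d)"
  shows "\<exists>f\<in>labellings G. Delta_v G f = int d \<and> 2 * Delta_e G f = \<bar>(int d)\<^sup>2 - int odd_parts\<bar>"
proof -
  let ?O = "{i \<in> I. odd (card (X i))}"
  have "(odd_parts + d) div 2 \<le> card ?O"
    using d(1) by (simp add: odd_parts_def)
  then obtain P where P: "P \<subseteq> ?O" "card P = (odd_parts + d) div 2"
    by (meson obtain_subset_with_card_n)
  define m where "m i = card (X i) div 2 + (if i \<in> P then 1 else 0)" for i
  have "\<exists>A. A \<subseteq> X i \<and> card A = m i" if "i \<in> I" for i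
  proof -
    have "m i \<le> card (X i)" using P(1) by (auto simp: m_def elim!: oddE)
    then show ?thesis by (meson obtain_subset_with_card_n)
  qed
  then obtain A where A: "\<And>i. i \<in> I \<Longrightarrow> A i \<subseteq> X i \<and> card (A i) = m i" by metis
  define f where
    "f x = (if x \<in> verts G then if x \<in> (\<Union>i\<in>I. A i) then 0 else 1 else undefined :: int)" for x
  have f: "f \<in> labellings G" by (auto simp: f_def labellings_def split: if_splits)
  have part: "signed_sum f (X i) = 2 * int (m i) - int (card (X i))" if i: "i \<in> I" for i
  proof -
    have fx: "f x = (if x \<in> A i then 0 else 1)" if x: "x \<in> X i" for x
    proof -
      have "x \<in> verts G" using i x by (auto simp: verts_eq)
      moreover have "x \<in> (\<Union>j\<in>I. A j) \<longleftrightarrow> x \<in> A i"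
      proof
        assume "x \<in> (\<Union>j\<in>I. A j)"
        then obtain j where j: "j \<in> I" "x \<in> A j" by blast
        with A have "x \<in> X j" by blast
        with x i j(1) disjoint have "j = i" by (auto simp: disjoint_family_on_def)
        with j show "x \<in> A i" by simp
      qed (use i in blast)
      ultimately show ?thesis by (simp add: f_def)
    qed
    have "signed_sum f (X i) = (\<Sum>x\<in>X i. 2 * (if x \<in> A i then 1 else 0) - 1)"
      unfolding signed_sum_def by (intro sum.cong) (auto simp: fx)
    also have "\<dots> = 2 * int (card (X i \<inter> A i)) - int (card (X i))"
      using finite_part[OF i] by (simp add: sum_subtractf sum.If_cases flip: sum_distrib_left)
    also have "X i \<inter> A i = A i" using A[OF i] by blast
    finally show ?thesis using A[OF i] by simp
  qed
  have part': "signed_sum f (X i)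
      = 2 * (if i \<in> P then 1 else 0) - (if odd (card (X i)) then 1 else 0)" if "i \<in> I" for i
    using part[OF that] P(1) by (auto simp: m_def elim!: oddE evenE)
  have odd_eq: "(\<Sum>i\<in>I. if odd (card (X i)) then 1 else 0) = int odd_parts"
    using finite_index by (simp add: odd_parts_def flip: sum.inter_filter)
  have "I \<inter> P = P" using P(1) by auto
  then have "(\<Sum>i\<in>I. if i \<in> P then 1 else (0::int)) = int (card P)"
    using finite_index by (simp add: sum.If_cases)
  then have "total_sum f = 2 * int (card P) - int odd_parts"
    unfolding total_sum_def using part' odd_eq
    by (simp add: sum_subtractf flip: sum_distrib_left)
  also have "2 * int (card P) = int odd_parts + int d"
    unfolding P(2) using d(2) by (metis even_two_times_div_two of_nat_add of_nat_mult of_nat_numeral)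
  finally have total: "total_sum f = int d" by simp
  have "squares f = (\<Sum>i\<in>I. if odd (card (X i)) then 1 else 0)"
    unfolding squares_def using P(1) by (intro sum.cong) (auto simp: part')
  then have "squares f = int odd_parts" using odd_eq by simp
  with f total show ?thesis
    using Delta_v_eq[OF f] two_Delta_e[OF f] by (intro bexI[of _ f]) auto
qed

section \<open>Bounds for the two minima\<close>

lemma D1_upper:
  assumes "d \<le> odd_parts" "even (odd_parts + d)"
  shows "2 * D1 G \<le> 2 * int d + \<bar>(int d)\<^sup>2 - int odd_parts\<bar>"
proof -
  obtain f where f: "f \<in> labellings G" "Delta_v G f = int d"
    "2 * Delta_e G f = \<bar>(int d)\<^sup>2 - int odd_parts\<bar>"
    using near_even_labelling[OF assms] by blast
  have "D1 G \<le> Delta_v G f + Delta_e G f"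
    unfolding D1_def using finite_labellings[OF simple] f(1) by (intro Min_le) auto
  then show ?thesis using f by linarith
qed

text \<open>
  For \<open>D = \<bar>total_sum f\<bar> < k\<close> the bound reduces to \<open>k\<^sup>2 - D\<^sup>2 \<ge> 2(k - D)\<close>, that is, to \<open>k + D \<ge> 2\<close>. The
  remaining case \<open>k = 1\<close>, \<open>D = 0\<close> holds because the imbalance of the edges is an integer.
\<close>

lemma D1_lower:
  assumes "k\<^sup>2 \<le> odd_parts"
  shows "int k \<le> D1 G"
proof -
  have "int k \<le> Delta_v G f + Delta_e G f" if f: "f \<in> labellings G" for f
  proof (cases "int k \<le> \<bar>total_sum f\<bar>")
    case True
    have "Delta_e G f \<ge> 0" by (simp add: Delta_e_def)
    with True show ?thesis using Delta_v_eq[OF f] by linarith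
  next
    case False
    define D where "D = \<bar>total_sum f\<bar>"
    have D: "0 \<le> D" "D < int k" "Delta_v G f = D" "(total_sum f)\<^sup>2 = D\<^sup>2"
      using False Delta_v_eq[OF f] by (auto simp: D_def)
    have "(int k)\<^sup>2 \<le> squares f"
      using assms odd_parts_le[of f] by (metis of_nat_le_iff of_nat_power order_trans)
    then have "(int k)\<^sup>2 - D\<^sup>2 \<le> 2 * Delta_e G f"
      using two_Delta_e[OF f] D(4) by linarith
    then have e: "(int k - D) * (int k + D) \<le> 2 * Delta_e G f"
      by (simp add: power2_eq_square algebra_simps)
    show ?thesis
    proof (cases "int k + D \<ge> 2")
      case True
      then have "(int k - D) * 2 \<le> (int k - D) * (int k + D)"
        using D by (intro mult_left_mono) auto
      then have "(int k - D) * 2 \<le> 2 * Delta_e G f" using e by (rule order_trans)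
      then have "int k - D \<le> Delta_e G f" by simp
      then show ?thesis using D(3) by simp
    next
      case False
      then have kD: "int k = 1" "D = 0" using D by auto
      then have "1 \<le> 2 * Delta_e G f" using e by simp
      then show ?thesis using D(3) kD by linarith
    qed
  qed
  then show ?thesis
    unfolding D1_def using finite_labellings[OF simple] labellings_nonempty
    by (subst Min_ge_iff) auto
qed

lemma D2_eq: "D2 G = int (odd_parts div 2)"
proof -
  let ?B = "{f \<in> labellings G. Delta_v G f \<le> 1}"
  have fin: "finite (Delta_e G ` ?B)" using finite_labellings[OF simple] by simp
  have "int (odd_parts div 2) \<le> Delta_e G f" if "f \<in> ?B" for f
  proof -
    have f: "f \<in> labellings G" "\<bar>total_sum f\<bar> \<le> 1" using that Delta_v_eq by auto
    have "(total_sum f)\<^sup>2 \<le> 1" using f(2) by (simp add: abs_square_le_1)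
    then have "int odd_parts - 1 \<le> 2 * Delta_e G f"
      using two_Delta_e[OF f(1)] odd_parts_le[of f] by linarith
    then show ?thesis by linarith
  qed
  then have "int (odd_parts div 2) \<le> D2 G"
    unfolding D2_def using fin balanced_labellings_nonempty[OF simple]
    by (subst Min_ge_iff) auto
  moreover have "D2 G \<le> int (odd_parts div 2)"
  proof -
    let ?d = "odd_parts mod 2"
    have "?d \<le> odd_parts" "even (odd_parts + ?d)" by auto
    then obtain f where f: "f \<in> labellings G" "Delta_v G f = int ?d"
      "2 * Delta_e G f = \<bar>(int ?d)\<^sup>2 - int odd_parts\<bar>"
      using near_even_labelling by blast
    have "(int ?d)\<^sup>2 = int ?d" by (cases "even odd_parts") (simp_all add: odd_iff_mod_2_eq_one)
    then have "Delta_e G f = int (odd_parts div 2)" using f(3) by presburger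
    moreover have "D2 G \<le> Delta_e G f"
      unfolding D2_def using fin f(1,2) by (intro Min_le) auto
    ultimately show ?thesis by simp
  qed
  ultimately show ?thesis by simp
qed

end

theorem theorem5p1:
  fixes r s a :: nat and n :: "nat \<Rightarrow> nat" and G :: "'a graph"
  assumes "r \<ge> 1"
    and "\<forall>i\<in>{1..r}. n i > 0"
    and "card {i \<in> {1..r}. odd (n i)} = s"
    and "(2 * a)\<^sup>2 \<le> s" and "s < (2 * a + 2)\<^sup>2"
    and "complete_multipartite r n G"
  shows
    "((\<exists>k::nat. s = k\<^sup>2) \<longrightarrow> real_of_int (D1 G) = sqrt (real s)) \<and>
     ((2 * a)\<^sup>2 < s \<and> s < (2 * a + 1)\<^sup>2 \<and> even s \<longrightarrow>
        real_of_int (D1 G) \<le> 1 / 2 * (real s + 1 - (2 * real a - 1)\<^sup>2)) \<and>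
     ((2 * a)\<^sup>2 < s \<and> s < (2 * a + 1)\<^sup>2 \<and> odd s \<longrightarrow>
        real_of_int (D1 G) \<le> 1 / 2 * (real s + 1 - (2 * real a - 2)\<^sup>2)) \<and>
     ((2 * a + 1)\<^sup>2 < s \<and> s < (2 * a + 2)\<^sup>2 \<and> even s \<longrightarrow>
        real_of_int (D1 G) \<le> 1 / 2 * (real s + 1 - (2 * real a - 1)\<^sup>2)) \<and>
     ((2 * a + 1)\<^sup>2 < s \<and> s < (2 * a + 2)\<^sup>2 \<and> odd s \<longrightarrow>
        real_of_int (D1 G) \<le> 1 / 2 * (real s + 1 - (2 * real a)\<^sup>2)) \<and>
     \<lfloor>sqrt (real s)\<rfloor> \<le> D1 G \<and> D1 G \<le> 3 * \<lfloor>sqrt (real s)\<rfloor> \<and>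
     D2 G = \<lfloor>real s / 2\<rfloor>"
proof -
  obtain X where X: "simple_graph G" "verts G = (\<Union>i\<in>{1..r}. X i)"
    "disjoint_family_on X {1..r}" "\<forall>i\<in>{1..r}. card (X i) = n i"
    "\<forall>i\<in>{1..r}. \<forall>j\<in>{1..r}. \<forall>x\<in>X i. \<forall>y\<in>X j. {x, y} \<in> edges G \<longleftrightarrow> i \<noteq> j"
    using assms(6) unfolding complete_multipartite_def by (elim conjE exE) (rule that)
  interpret multipartite G "{1..r}" X
    using X by unfold_locales auto
  have "{i \<in> {1..r}. odd (card (X i))} = {i \<in> {1..r}. odd (n i)}" using X(4) by auto
  then have s: "odd_parts = s" using assms(3) unfolding odd_parts_def by simp
  define k where "k = nat \<lfloor>sqrt (real s)\<rfloor>"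
  have k_eq: "\<lfloor>sqrt (real s)\<rfloor> = int k" by (simp add: k_def)
  have "real k \<le> sqrt (real s)" "sqrt (real s) < real k + 1"
    using k_eq by linarith+
  then have "(real k)\<^sup>2 \<le> real s" "real s < (real k + 1)\<^sup>2"
    using power_mono[of "real k" "sqrt (real s)" 2]
      power_strict_mono[of "sqrt (real s)" "real k + 1" 2] by auto
  then have "real (k\<^sup>2) \<le> real s" "real s < real ((k + 1)\<^sup>2)" by (simp_all add: add.commute)
  then have k: "k\<^sup>2 \<le> s" "s < (k + 1)\<^sup>2" by (simp_all only: of_nat_le_iff of_nat_less_iff)
  have lower: "int k \<le> D1 G" using D1_lower k(1) s by simp
  have upper: "real_of_int (D1 G) \<le> 1 / 2 * (real s + 1 - (real d - 1)\<^sup>2)"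
    if d: "d\<^sup>2 \<le> s" "even (s + d)" for d
  proof -
    have "d \<le> d\<^sup>2" by (simp add: power2_eq_square)
    moreover have "(int d)\<^sup>2 \<le> int s" using d(1) by (metis of_nat_le_iff of_nat_power)
    ultimately have "2 * D1 G \<le> 2 * int d + (int s - (int d)\<^sup>2)"
      using D1_upper[of d] d s by simp
    then have "real_of_int (2 * D1 G) \<le> real_of_int (2 * int d + (int s - (int d)\<^sup>2))"
      by (simp only: of_int_le_iff)
    then show ?thesis by (simp add: power2_eq_square algebra_simps)
  qed
  have "real_of_int (D1 G) = sqrt (real s)" if m: "s = m\<^sup>2" for m
  proof -
    have "k = m" using k_eq m by (simp add: k_def)
    moreover have "real_of_int (D1 G) \<le> real m"
      using upper[of m] m by (simp add: power2_eq_square algebra_simps)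
    ultimately show ?thesis using lower m by simp
  qed
  moreover have "real_of_int (D1 G) \<le> 1 / 2 * (real s + 1 - (2 * real a - 1)\<^sup>2)" if "even s"
    using upper[of "2 * a"] assms(4) that by simp
  moreover have "real_of_int (D1 G) \<le> 1 / 2 * (real s + 1 - (2 * real a - 2)\<^sup>2)"
    if "(2 * a)\<^sup>2 < s" "s < (2 * a + 1)\<^sup>2" "odd s"
  proof -
    have "a \<noteq> 0" using that by (intro notI) simp
    then obtain b where b: "a = Suc b" by (cases a) auto
    have "(2 * b + 1)\<^sup>2 \<le> (2 * a)\<^sup>2" using b by (intro power_mono) auto
    then have "(2 * b + 1)\<^sup>2 \<le> s" using that(1) by linarith
    then show ?thesis using upper[of "2 * b + 1"] that(3) b by simp
  qed
  moreover have "real_of_int (D1 G) \<le> 1 / 2 * (real s + 1 - (2 * real a)\<^sup>2)"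
    if "(2 * a + 1)\<^sup>2 < s" "odd s"
    using upper[of "2 * a + 1"] that by simp
  \<comment> \<open>Since \<open>s \<le> k\<^sup>2 + 2k\<close>, the bound at \<open>k\<close> is at most \<open>2k\<close>, and the one at \<open>k - 1\<close>, for the other
      parity of \<open>s\<close>, is below \<open>3k\<close>.\<close>
  moreover have "D1 G \<le> 3 * int k"
  proof -
    have "s \<le> k * k + 2 * k" using k(2) by (simp add: power2_eq_square)
    then have sk: "real s \<le> real k * real k + 2 * real k"
      by (metis of_nat_add of_nat_le_iff of_nat_mult of_nat_numeral)
    have "real_of_int (D1 G) \<le> 3 * real k"
    proof (cases "even (s + k)")
      case True
      then show ?thesis
        using upper[of k] k(1) sk by (simp add: power2_eq_square algebra_simps)
    next
      case False
      then have "k \<noteq> 0" using k(2) by (intro notI) simp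
      then obtain j where j: "k = Suc j" by (cases k) auto
      have "j\<^sup>2 \<le> k\<^sup>2" using j by (intro power_mono) auto
      then have "j\<^sup>2 \<le> s" using k(1) by linarith
      then show ?thesis
        using upper[of j] False j sk by (simp add: power2_eq_square algebra_simps)
    qed
    then show ?thesis by linarith
  qed
  moreover have "D2 G = \<lfloor>real s / 2\<rfloor>"
    using D2_eq s floor_divide_of_nat_eq[of s 2, where 'a = real] by simp
  ultimately show ?thesis
    using lower k_eq by auto
qed

end
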